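(* Let $p$ be a prime and $n\ge k\ge 1$ integers such that $S(n,k)$ is a minimum zero case. Then $\nu_p(S(n+1,k+1))=\nu_p(S(n,k))$ and $\epsilon_p(S(n+1,k+1))\equiv\epsilon_p(S(n,k)) \pmod p$.
   Context: $S(n,k)$ is the Stirling number of the second kind, $\nu_p$ the $p$-adic valuation, $\sigma_p(m)$ the base-$p$ digit sum, and $\epsilon_p(x)=p^{-\nu_p(x)}x$ the unit part of a nonzero rational $x$. $S(n,k)$ is called a minimum zero case if $\nu_p(S(n,k)) = (\sigma_p(k)-\sigma_p(n))/(p-1)$. *)

theory Defs
  imports Complex_Main "HOL-Combinatorics.Stirling" "HOL-Computational_Algebra.Primes" "HOL-Number_Theory.Cong"
begin

text \<open>The recursion is meaningful for bases \<open>b \<ge> 2\<close>; for \<open>b < 2\<close> the value is a dummy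
  that only serves termination.\<close>

function digit_sum :: "nat \<Rightarrow> nat \<Rightarrow> nat" where
  "digit_sum b m = (if b < 2 \<or> m = 0 then 0 else m mod b + digit_sum b (m div b))"
  by auto
termination by (relation "measure snd") auto

declare digit_sum.simps [simp del]

text \<open>With \<open>x = a / c\<close> in lowest terms. The value at \<open>x = 0\<close> is the dummy \<open>0\<close>.\<close>

definition padic_val :: "nat \<Rightarrow> rat \<Rightarrow> int" where
  "padic_val p x = int (multiplicity (int p) (fst (quotient_of x)))
                 - int (multiplicity (int p) (snd (quotient_of x)))"

definition unit_part :: "nat \<Rightarrow> rat \<Rightarrow> rat" where
  "unit_part p x = of_nat p powi (- padic_val p x) * x"

text \<open>Congruence modulo \<open>p\<close> of rationals, i.e. modulo \<open>p\<int>\<^sub>(\<^sub>p\<^sub>)\<close>, the multiples of \<open>p\<close> in the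
  ring of fractions with denominator prime to \<open>p\<close>.\<close>

definition rat_cong :: "nat \<Rightarrow> rat \<Rightarrow> rat \<Rightarrow> bool" where
  "rat_cong p x y \<longleftrightarrow>
     (\<exists>a c :: int. \<not> int p dvd c \<and> x - y = of_nat p * (of_int a / of_int c))"

definition minimum_zero_case :: "nat \<Rightarrow> nat \<Rightarrow> nat \<Rightarrow> bool" where
  "minimum_zero_case p n k \<longleftrightarrow>
     (of_int (padic_val p (of_nat (Stirling n k))) :: rat) =
       (of_nat (digit_sum p k) - of_nat (digit_sum p n)) / (of_nat p - 1)"

text \<open>On natural numbers and integers these notions agree with the library's.\<close>

lemma padic_val_of_nat: "padic_val p (of_nat m) = int (multiplicity p m)"
proof -
  have "quotient_of (of_nat m) = (int m, 1)"
    using quotient_of_int[of "int m"] by (simp del: quotient_of_int)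
  moreover have "multiplicity (int p) (int m) = multiplicity p m"
    unfolding multiplicity_def by (simp flip: of_nat_power)
  moreover have "multiplicity (int p) 1 = 0"
    by (cases "p = 1") (auto simp: not_dvd_imp_multiplicity_0 multiplicity_unit_left)
  ultimately show ?thesis by (simp add: padic_val_def)
qed

lemma unit_part_of_nat: "unit_part p (of_nat m) = of_nat (m div p ^ multiplicity p m)"
proof (cases "p = 0")
  case True
  then show ?thesis
    by (simp add: unit_part_def padic_val_of_nat)
next
  case False
  obtain q where q: "m = p ^ multiplicity p m * q"
    using multiplicity_dvd[of p m] by (elim dvdE)
  have "unit_part p (of_nat m) = of_nat m / of_nat p ^ multiplicity p m"
    by (simp add: unit_part_def padic_val_of_nat power_int_minus divide_inverse)
  also have "\<dots> = of_nat (m div p ^ multiplicity p m)"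
  proof -
    have "(of_nat m :: rat) = of_nat p ^ multiplicity p m * of_nat q"
      using arg_cong[OF q, of "of_nat :: nat \<Rightarrow> rat"] by (simp only: of_nat_mult of_nat_power)
    moreover have "m div p ^ multiplicity p m = q"
      using q False by (metis nonzero_mult_div_cancel_left power_not_zero)
    ultimately show ?thesis using False by (metis nonzero_mult_div_cancel_left of_nat_eq_0_iff power_not_zero)
  qed
  finally show ?thesis .
qed

lemma rat_cong_of_int:
  assumes "prime p"
  shows "rat_cong p (of_int x) (of_int y) \<longleftrightarrow> [x = y] (mod int p)"
proof
  assume "rat_cong p (of_int x) (of_int y)"
  then obtain a c where c: "\<not> int p dvd c"
    and eq: "(of_int x :: rat) - of_int y = of_nat p * (of_int a / of_int c)"
    by (auto simp: rat_cong_def)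
  from c have "c \<noteq> 0" by auto
  with eq have "(of_int ((x - y) * c) :: rat) = of_int (int p * a)"
    by (simp add: field_simps)
  then have "(x - y) * c = int p * a"
    by (simp only: of_int_eq_iff)
  then have "int p dvd (x - y) * c" by simp
  with c assms have "int p dvd x - y"
    using prime_dvd_mult_iff[of "int p"] by auto
  then show "[x = y] (mod int p)" by (simp add: cong_iff_dvd_diff)
next
  assume "[x = y] (mod int p)"
  then obtain a where a: "x - y = int p * a"
    by (auto simp: cong_iff_dvd_diff elim: dvdE)
  have "\<not> int p dvd 1" using assms by (auto simp: prime_gt_0_nat)
  moreover have "(of_int x :: rat) - of_int y = of_nat p * (of_int a / of_int 1)"
    using arg_cong[OF a, of "of_int :: int \<Rightarrow> rat"] by simp
  ultimately show "rat_cong p (of_int x) (of_int y)"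
    unfolding rat_cong_def by blast
qed

end

theory Submission
  imports Defs
begin

text \<open>Write \<open>\<sigma>\<close> for the base-\<open>p\<close> digit sum and \<open>\<nu>\<close> for the \<open>p\<close>-adic valuation. Every nonzero
  \<open>S(n, k)\<close> satisfies \<open>(p - 1) \<nu>(S(n, k)) \<ge> \<sigma>(k) - \<sigma>(n)\<close>: this follows by induction on \<open>k\<close> from
  \<open>(k + 1) S(n, k + 1) = \<Sum>\<^bsub>j<n\<^esub> (n choose j) S(j, k)\<close> and the digit sum formulas for the valuations
  of \<open>n choose j\<close> and \<open>k + 1\<close>. Applied to \<open>S(n, k + 1)\<close>, the bound shows that in a minimum zero case
  the second summand of \<open>S(n + 1, k + 1) = S(n, k) + (k + 1) S(n, k + 1)\<close> has strictly larger
  valuation than the first.\<close>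

section \<open>Digit sums and valuations of factorials and binomial coefficients\<close>

lemma digit_sum_0 [simp]: "digit_sum b 0 = 0"
  by (simp add: digit_sum.simps)

lemma digit_sum_mult_add:
  assumes "b \<ge> 2" "r < b"
  shows "digit_sum b (b * q + r) = r + digit_sum b q"
proof (cases "b * q + r = 0")
  case True
  with assms show ?thesis by auto
next
  case False
  with assms show ?thesis
    by (subst digit_sum.simps) auto
qed

lemma digit_sum_pos:
  assumes "b \<ge> 2" "m > 0"
  shows "digit_sum b m > 0"
  using assms(2)
proof (induction m rule: less_induct)
  case (less m)
  have eq: "digit_sum b m = m mod b + digit_sum b (m div b)"
    using less.prems assms(1) by (subst digit_sum.simps) auto
  show ?case
  proof (cases "m mod b = 0")
    case True
    then have "m div b > 0"
      using less.prems by (metis add.right_neutral mult_0_right mult_div_mod_eq neq0_conv)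
    moreover have "m div b < m"
      using less.prems assms(1) by simp
    ultimately show ?thesis using less.IH eq by simp
  qed (use eq in simp)
qed

text \<open>Adding one to \<open>k\<close> turns its trailing digits \<open>p - 1\<close> into zeros
  and raises the next digit by one. There are \<open>multiplicity p (Suc k)\<close> such trailing
  digits, each lowering the digit sum by \<open>p - 1\<close>.\<close>

lemma multiplicity_Suc_digit_sum:
  assumes "prime p"
  shows "(p - 1) * multiplicity p (Suc k) + digit_sum p (Suc k) = Suc (digit_sum p k)"
proof (induction k rule: less_induct)
  case (less k)
  define q r where "q = k div p" and "r = k mod p"
  have p2: "p \<ge> 2" using assms by (rule prime_ge_2_nat)
  have r: "r < p" and k: "k = p * q + r"
    using p2 by (simp_all add: q_def r_def)
  have dk: "digit_sum p k = r + digit_sum p q"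
    using digit_sum_mult_add[OF p2 r] k by simp
  show ?case
  proof (cases "Suc r = p")
    case False
    then have "Suc r < p" using r by simp
    then have "digit_sum p (Suc k) = Suc r + digit_sum p q"
      using digit_sum_mult_add[OF p2, of "Suc r" q] k by simp
    moreover have "\<not> p dvd Suc k"
    proof
      assume "p dvd Suc k"
      then have "p dvd Suc r"
        using k dvd_add_right_iff[of p "p * q" "Suc r"] by simp
      with \<open>Suc r < p\<close> show False by (simp add: nat_dvd_not_less)
    qed
    ultimately show ?thesis
      using dk by (simp add: not_dvd_imp_multiplicity_0)
  next
    \<comment> \<open>The last digit is \<open>p - 1\<close>, so the carry passes on to
      \<open>q\<close> and contributes one factor \<open>p\<close>.\<close>
    case True
    then have k': "Suc k = p * Suc q" using k by simp
    then have "q < k" using p2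
      by (metis One_nat_def Suc_1 Suc_le_eq Suc_less_eq n_less_m_mult_n zero_less_Suc)
    then have IH: "(p - 1) * multiplicity p (Suc q) + digit_sum p (Suc q) = Suc (digit_sum p q)"
      by (rule less.IH)
    have "digit_sum p (Suc k) = digit_sum p (Suc q)"
      using digit_sum_mult_add[OF p2, of 0 "Suc q"] p2 k' by simp
    moreover have "multiplicity p (Suc k) = Suc (multiplicity p (Suc q))"
      unfolding k' using assms by (intro multiplicity_times_same) auto
    moreover have "r = p - 1" using True by simp
    ultimately show ?thesis using dk IH by simp
  qed
qed

text \<open>Legendre's formula, obtained by adding up the carry identity over the factors of
  \<open>fact m\<close>.\<close>

lemma multiplicity_fact_digit_sum:
  assumes "prime p"
  shows "(p - 1) * multiplicity p (fact m :: nat) + digit_sum p m = m"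
proof (induction m)
  case (Suc m)
  have "multiplicity p (fact (Suc m) :: nat) = multiplicity p (Suc m) + multiplicity p (fact m :: nat)"
    using assms unfolding fact_Suc of_nat_id
    by (intro prime_elem_multiplicity_mult_distrib) auto
  then show ?case
    using Suc multiplicity_Suc_digit_sum[OF assms, of m] by (simp add: algebra_simps)
qed simp

text \<open>The digit sum form of Kummer's theorem: Legendre's formula for the three factorials in
  \<open>n choose j\<close>.\<close>

lemma multiplicity_binomial_digit_sum:
  assumes "prime p" "j \<le> n"
  shows "(p - 1) * multiplicity p (n choose j) + digit_sum p n = digit_sum p j + digit_sum p (n - j)"
proof -
  have "multiplicity p (fact n :: nat) =
      multiplicity p (fact j :: nat) + multiplicity p (fact (n - j) :: nat) + multiplicity p (n choose j)"
    using assms binomial_fact_lemma[OF assms(2)]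
    by (metis prime_elem_multiplicity_mult_distrib prime_imp_prime_elem fact_nonzero
        no_zero_divisors zero_less_binomial less_numeral_extra(3))
  from arg_cong[OF this, of "\<lambda>x. (p - 1) * x"] show ?thesis
    using multiplicity_fact_digit_sum[OF assms(1), of n] multiplicity_fact_digit_sum[OF assms(1), of j]
      multiplicity_fact_digit_sum[OF assms(1), of "n - j"] assms(2)
    unfolding distrib_left by linarith
qed

section \<open>Identities and positivity for Stirling numbers\<close>

text \<open>Combinatorially, \<open>j\<close> counts the elements outside the block of one
  distinguished element. The proof is instead an induction with Pascal's rule.\<close>

lemma Stirling_Suc_Suc_eq_sum: "Stirling (Suc n) (Suc k) = (\<Sum>j\<le>n. (n choose j) * Stirling j k)"
proof (induction n arbitrary: k)
  case (Suc n)
  have shift: "(\<Sum>j\<le>Suc n. (Suc n choose j) * f j) =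
      (\<Sum>j\<le>n. (n choose j) * f j) + (\<Sum>j\<le>n. (n choose j) * f (Suc j))" for f :: "nat \<Rightarrow> nat"
  proof -
    have "(\<Sum>j\<le>Suc n. (Suc n choose j) * f j) = f 0 + (\<Sum>j\<le>n. (Suc n choose Suc j) * f (Suc j))"
      by (subst sum.atMost_Suc_shift) simp
    also have "\<dots> = f 0 + (\<Sum>j\<le>n. (n choose Suc j) * f (Suc j)) + (\<Sum>j\<le>n. (n choose j) * f (Suc j))"
      by (simp add: algebra_simps sum.distrib)
    also have "f 0 + (\<Sum>j\<le>n. (n choose Suc j) * f (Suc j)) = (\<Sum>j\<le>Suc n. (n choose j) * f j)"
      by (subst sum.atMost_Suc_shift) simp
    also have "\<dots> = (\<Sum>j\<le>n. (n choose j) * f j)"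
      by simp
    finally show ?thesis .
  qed
  show ?case
  proof (cases k)
    case 0
    have "(\<Sum>j\<le>n. (n choose j) * Stirling (Suc j) 0) = 0" by simp
    then show ?thesis
      using Suc.IH[of 0] unfolding 0 shift by simp
  next
    \<comment> \<open>The recurrence for \<open>Stirling (Suc j) (Suc l)\<close> produces sums for
      both \<open>Suc l\<close> and \<open>l\<close>, which is why \<open>k\<close> is arbitrary in
      the induction.\<close>
    case k: (Suc l)
    have "(\<Sum>j\<le>n. (n choose j) * Stirling (Suc j) (Suc l)) =
        Suc l * (\<Sum>j\<le>n. (n choose j) * Stirling j (Suc l)) + (\<Sum>j\<le>n. (n choose j) * Stirling j l)"
      by (simp add: algebra_simps sum.distrib sum_distrib_left)
    then show ?thesis
      unfolding k shift Suc.IH[symmetric] by simp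
  qed
qed (cases k, auto)

text \<open>The term \<open>j = n\<close> of the previous sum is \<open>Stirling n k\<close>; it
  cancels against the same summand of the recurrence.\<close>

lemma Suc_times_Stirling_eq_sum:
  "Suc k * Stirling n (Suc k) = (\<Sum>j<n. (n choose j) * Stirling j k)"
  using Stirling_Suc_Suc_eq_sum[of n k]
  by (simp flip: lessThan_Suc_atMost)

lemma Stirling_pos:
  assumes "1 \<le> k" "k \<le> n"
  shows "Stirling n k > 0"
  using assms
proof (induction n arbitrary: k)
  case (Suc n)
  show ?case
  proof (cases "k = Suc n")
    case False
    with Suc.prems have "Stirling n k > 0" by (intro Suc.IH) auto
    moreover obtain l where "k = Suc l" using Suc.prems by (cases k) auto
    ultimately show ?thesis by simp
  qed simp
qed simp

section \<open>The digit sum lower bound for the valuation\<close>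

text \<open>Ultrametric inequality. Zero terms are exempt from the bound because
  \<open>multiplicity p 0\<close> is \<open>0\<close> by convention. The factor \<open>m\<close>
  will be \<open>p - 1\<close>, which avoids division.\<close>

lemma multiplicity_sum_ge:
  fixes f :: "'a \<Rightarrow> nat" and p c m :: nat
  assumes p: "p > 1" and nz: "sum f A \<noteq> 0"
    and ge: "\<And>x. x \<in> A \<Longrightarrow> f x \<noteq> 0 \<Longrightarrow> c \<le> m * multiplicity p (f x)"
  shows "c \<le> m * multiplicity p (sum f A)"
proof -
  let ?B = "{x \<in> A. f x \<noteq> 0}"
  have "finite A" using nz by (rule contrapos_np) (rule sum.infinite)
  then have fin: "finite ?B" by simp
  have ne: "?B \<noteq> {}" by (rule sum.not_neutral_contains_not_neutral[OF nz]) auto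
  define x where "x = arg_min_on (\<lambda>x. multiplicity p (f x)) ?B"
  have x: "x \<in> ?B" and min: "\<And>y. y \<in> ?B \<Longrightarrow> multiplicity p (f x) \<le> multiplicity p (f y)"
    unfolding x_def by (rule arg_min_if_finite(1)[OF fin ne], rule arg_min_least[OF fin ne])
  have "p ^ multiplicity p (f x) dvd sum f A"
  proof (rule dvd_sum)
    fix y assume "y \<in> A"
    then show "p ^ multiplicity p (f x) dvd f y"
      using min[of y] by (cases "f y = 0") (auto intro: multiplicity_dvd')
  qed
  then have "multiplicity p (f x) \<le> multiplicity p (sum f A)"
    using p nz by (intro multiplicity_geI) auto
  then have "m * multiplicity p (f x) \<le> m * multiplicity p (sum f A)" by (rule mult_le_mono2)
  moreover have "c \<le> m * multiplicity p (f x)" using ge x by blast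
  ultimately show ?thesis by (rule le_trans[rotated])
qed

lemma multiplicity_Stirling_ge:
  assumes "prime p" "Stirling n k \<noteq> 0"
  shows "digit_sum p k \<le> (p - 1) * multiplicity p (Stirling n k) + digit_sum p n"
  using assms(2)
proof (induction k arbitrary: n)
  case (Suc k)
  \<comment> \<open>Truncated subtraction loses nothing here: on naturals,
    \<open>x - y \<le> z\<close> is equivalent to \<open>x \<le> z + y\<close>.\<close>
  have "Suc (digit_sum p k) - digit_sum p n
      \<le> (p - 1) * multiplicity p (\<Sum>j<n. (n choose j) * Stirling j k)"
  proof (rule multiplicity_sum_ge)
    show "p > 1" using assms(1) by (rule prime_gt_1_nat)
    show "(\<Sum>j<n. (n choose j) * Stirling j k) \<noteq> 0"
      unfolding Suc_times_Stirling_eq_sum[symmetric] using Suc.prems by simp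
    fix j assume j: "j \<in> {..<n}" and nz: "(n choose j) * Stirling j k \<noteq> 0"
    have "digit_sum p k \<le> (p - 1) * multiplicity p (Stirling j k) + digit_sum p j"
      using nz by (intro Suc.IH) auto
    moreover have "(p - 1) * multiplicity p (n choose j) + digit_sum p n
        = digit_sum p j + digit_sum p (n - j)"
      using j by (intro multiplicity_binomial_digit_sum[OF assms(1)]) auto
    \<comment> \<open>Since \<open>j < n\<close>, this gains the extra one in
      \<open>Suc (digit_sum p k)\<close>, just what dividing by \<open>Suc k\<close> costs at the
      end.\<close>
    moreover have "digit_sum p (n - j) > 0"
      using j prime_ge_2_nat[OF assms(1)] by (intro digit_sum_pos) auto
    moreover have "multiplicity p ((n choose j) * Stirling j k)
        = multiplicity p (n choose j) + multiplicity p (Stirling j k)"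
      using assms(1) nz by (intro prime_elem_multiplicity_mult_distrib) auto
    ultimately show "Suc (digit_sum p k) - digit_sum p n
        \<le> (p - 1) * multiplicity p ((n choose j) * Stirling j k)"
      by (simp add: distrib_left)
  qed
  also have "multiplicity p (\<Sum>j<n. (n choose j) * Stirling j k)
      = multiplicity p (Suc k) + multiplicity p (Stirling n (Suc k))"
    unfolding Suc_times_Stirling_eq_sum[symmetric]
    using assms(1) Suc.prems by (intro prime_elem_multiplicity_mult_distrib) auto
  finally show ?case
    using multiplicity_Suc_digit_sum[OF assms(1), of k] by (simp add: distrib_left)
qed simp

section \<open>Minimum zero cases and unit parts modulo \<open>p\<close>\<close>

lemma minimum_zero_case_iff:
  assumes "prime p"
  shows "minimum_zero_case p n k \<longleftrightarrow>
    (p - 1) * multiplicity p (Stirling n k) + digit_sum p n = digit_sum p k"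
proof -
  have p: "p > 1" using assms by (rule prime_gt_1_nat)
  then have "minimum_zero_case p n k \<longleftrightarrow>
      (of_nat ((p - 1) * multiplicity p (Stirling n k) + digit_sum p n) :: rat) = of_nat (digit_sum p k)"
    by (auto simp: minimum_zero_case_def padic_val_of_nat of_nat_diff field_simps)
  then show ?thesis by (simp only: of_nat_eq_iff)
qed

text \<open>With \<open>v = multiplicity p a\<close>, \<open>a = p ^ v * u\<close> and
  \<open>r = p ^ v * (p * t)\<close>, the sum is \<open>p ^ v * (u + p * t)\<close>, and
  \<open>u + p * t\<close> is congruent to \<open>u\<close>.\<close>

lemma multiplicity_add_of_power_dvd:
  fixes p a r :: nat
  assumes "prime p" "a \<noteq> 0" "p ^ Suc (multiplicity p a) dvd r"
  shows "multiplicity p (a + r) = multiplicity p a"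
    and "[(a + r) div p ^ multiplicity p a = a div p ^ multiplicity p a] (mod p)"
proof -
  have p: "\<not> is_unit p" using assms(1) by auto
  have "\<not> p ^ Suc (multiplicity p a) dvd a"
    using assms(2) p by (simp add: power_dvd_iff_le_multiplicity del: power_Suc)
  then have "\<not> p ^ Suc (multiplicity p a) dvd a + r"
    using assms(3) dvd_add_left_iff by blast
  moreover have "p ^ multiplicity p a dvd r"
    using assms(3) by (metis dvd_mult_right power_Suc)
  then have "p ^ multiplicity p a dvd a + r"
    by (intro dvd_add multiplicity_dvd)
  ultimately show "multiplicity p (a + r) = multiplicity p a"
    by (intro multiplicity_eqI) auto
  obtain t where t: "r = p ^ multiplicity p a * (p * t)"
    using assms(3) by (metis dvd_def mult.assoc power_Suc2)
  have "p ^ multiplicity p a > 0" using assms(1) by (simp add: prime_gt_0_nat)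
  then have "(a + r) div p ^ multiplicity p a = a div p ^ multiplicity p a + p * t"
    unfolding t by (simp add: div_mult_self2)
  then show "[(a + r) div p ^ multiplicity p a = a div p ^ multiplicity p a] (mod p)"
    by (simp add: cong_def)
qed

theorem theorem2p5:
  fixes p n k :: nat
  assumes "prime p"
    and "1 \<le> k" and "k \<le> n"
    and "minimum_zero_case p n k"
  shows "padic_val p (of_nat (Stirling (n + 1) (k + 1))) = padic_val p (of_nat (Stirling n k)) \<and>
         rat_cong p (unit_part p (of_nat (Stirling (n + 1) (k + 1))))
                    (unit_part p (of_nat (Stirling n k)))"
proof -
  let ?a = "Stirling n k" and ?r = "Suc k * Stirling n (Suc k)"
  have rec: "Stirling (n + 1) (k + 1) = ?a + ?r" by simp
  have "p ^ Suc (multiplicity p ?a) dvd ?r"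
  \<comment> \<open>If this number vanishes, as for \<open>n = k\<close>, then \<open>?r\<close> is
    zero and the divisibility is trivial.\<close>
  proof (cases "Stirling n (Suc k) = 0")
    case False
    have "multiplicity p ?r = multiplicity p (Suc k) + multiplicity p (Stirling n (Suc k))"
      using assms(1) False by (intro prime_elem_multiplicity_mult_distrib) auto
    \<comment> \<open>The lower bound and the carry identity make the right side at least
      \<open>Suc (digit_sum p k) - digit_sum p n\<close>; the left side equals
      \<open>digit_sum p k - digit_sum p n\<close> by minimality.\<close>
    then have "(p - 1) * multiplicity p ?a < (p - 1) * multiplicity p ?r"
      using multiplicity_Stirling_ge[OF assms(1) False] multiplicity_Suc_digit_sum[OF assms(1), of k]
        assms(4)[unfolded minimum_zero_case_iff[OF assms(1)]]
      by (simp add: distrib_left)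
    then show ?thesis by (intro multiplicity_dvd') simp
  qed simp
  moreover have "?a \<noteq> 0" using Stirling_pos assms(2,3) by simp
  ultimately have *: "multiplicity p (?a + ?r) = multiplicity p ?a"
      "[(?a + ?r) div p ^ multiplicity p ?a = ?a div p ^ multiplicity p ?a] (mod p)"
    using multiplicity_add_of_power_dvd[OF assms(1)] by blast+
  have "rat_cong p (of_nat ((?a + ?r) div p ^ multiplicity p ?a)) (of_nat (?a div p ^ multiplicity p ?a))"
    using *(2) rat_cong_of_int[OF assms(1), of "int _" "int _"] by (simp add: cong_int_iff)
  with *(1) show ?thesis
    unfolding rec padic_val_of_nat unit_part_of_nat by simp
qed

end
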